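(* Let $G$ be a finite simple graph and let $\overline{G}$ denote its complement. If the vertex cover number of $\overline{G}$ satisfies $\alpha_0(\overline{G}) \leq 3$, then the $\sigma$-polynomial $\sigma(G,x)$ has only real roots.
   Context: For a graph $G$ of order $n$ with chromatic number $\chi(G)$, the $\sigma$-polynomial of $G$ is $\sigma(G,x)=\sum_{i=\chi(G)}^{n} a_i x^i$, where $a_i$ is the number of partitions of the vertex set of $G$ into $i$ nonempty independent sets. A vertex cover of a graph $H$ is a set $S$ of vertices such that every edge of $H$ has at least one endpoint in $S$; the vertex cover number $\alpha_0(H)$ is the minimum size of a vertex cover of $H$. *)

theory Defs
  imports
    "HOL-Library.Ramsey"
    "HOL-Library.Disjoint_Sets"
    "HOL-Computational_Algebra.Computational_Algebra"
begin

text \<open>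
  A graph is a vertex set \<open>V\<close> together with a set \<open>E\<close> of edges, each edge being a two-element
  subset of \<open>V\<close>; so loops and multiple edges are excluded. This is the representation used
  by \<^const>\<open>clique\<close> and \<^const>\<open>indep\<close>. The null graph is allowed.
\<close>

definition finite_simple_graph :: "'a set \<Rightarrow> 'a set set \<Rightarrow> bool" where
  "finite_simple_graph V E \<longleftrightarrow> finite V \<and> E \<subseteq> [V]\<^bsup>2\<^esup>"

definition complement_edges :: "'a set \<Rightarrow> 'a set set \<Rightarrow> 'a set set" where
  "complement_edges V E = [V]\<^bsup>2\<^esup> - E"

definition vertex_cover :: "'a set \<Rightarrow> 'a set set \<Rightarrow> 'a set \<Rightarrow> bool" where
  "vertex_cover V E S \<longleftrightarrow> S \<subseteq> V \<and> (\<forall>e\<in>E. e \<inter> S \<noteq> {})"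

definition vertex_cover_number :: "'a set \<Rightarrow> 'a set set \<Rightarrow> nat" where
  "vertex_cover_number V E = (LEAST k. \<exists>S. vertex_cover V E S \<and> card S = k)"

definition proper_colouring :: "'a set \<Rightarrow> 'a set set \<Rightarrow> nat \<Rightarrow> ('a \<Rightarrow> nat) \<Rightarrow> bool" where
  "proper_colouring V E k f \<longleftrightarrow>
     f ` V \<subseteq> {..<k} \<and> (\<forall>u\<in>V. \<forall>v\<in>V. {u, v} \<in> E \<longrightarrow> f u \<noteq> f v)"

definition chromatic_number :: "'a set \<Rightarrow> 'a set set \<Rightarrow> nat" where
  "chromatic_number V E = (LEAST k. \<exists>f. proper_colouring V E k f)"

definition indep_partitions :: "'a set \<Rightarrow> 'a set set \<Rightarrow> nat \<Rightarrow> 'a set set set" where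
  "indep_partitions V E i = {P. partition_on V P \<and> card P = i \<and> (\<forall>B\<in>P. indep B E)}"

definition sigma_poly :: "'a set \<Rightarrow> 'a set set \<Rightarrow> real poly" where
  "sigma_poly V E =
     (\<Sum>i = chromatic_number V E..card V. monom (real (card (indep_partitions V E i))) i)"

end

(* Since I = V - S is a clique of G, every block of a partition into independent sets contains
   at most one vertex of I, so sigma(G, x) = x^|I| q(x), where q enumerates the partitions by the
   number of blocks contained in S. For |S| = 3 this q is a monic cubic (z + k) g(z) + h(z) with
   g a quadratic and h linear, and its roots are real because h separates the roots of g. The
   choice of g and the separation inequality depend on the number of complement edges inside S. *)

theory Submission
  imports Defs
begin

text \<open>In every case \<open>g\<close> is the residual polynomial of two of the three cover
  vertices, and \<open>k\<close> starts as the complement degree into \<open>I\<close> of the third.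
  Separation suffices for this reason: at the roots of \<open>g\<close> the cubic equals
  \<open>h\<close>, whose slope \<alpha> is \<le> 0, so the cubic is \<ge> 0 at the smaller root and
  \<le> 0 at the larger one, and the signs at infinity yield three real roots. For \<alpha> < 0
  separation reads \<alpha>^2 * g(-\<beta>/\<alpha>) \<le> 0, which expands to a polynomial
  condition that still makes sense for \<alpha> = 0. Counting sign changes would need extra care
  with coincident roots, so a nonreal root is excluded directly instead. With two or three
  complement edges inside the cover, the part beyond \<open>(z + k) * g\<close> is the quadratic
  \<open>z * g'(z)\<close>; splitting off \<open>2 * g\<close> makes it linear and turns
  \<open>k\<close> into \<open>k + 2\<close>.\<close>

section \<open>Real-rootedness of the cubics\<close>

lemma nonpos_if_mult_nonpos: "a * b \<le> 0 \<Longrightarrow> 0 < a \<Longrightarrow> b \<le> (0::real)"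
  by (simp add: mult_le_0_iff)

text \<open>
  For nonreal \<open>z\<close>, multiply by the conjugate of \<open>g = z\<^sup>2 + b * z + c\<close> and take imaginary parts:
  this gives \<open>\<bar>g\<bar>\<^sup>2 + N = 0\<close>, and the resultant condition \<open>res\<close> makes \<open>N\<close> nonnegative.
\<close>
lemma cubic_root_real:
  fixes z :: complex and k b c \<alpha> \<beta> :: real
  assumes root: "(z + k) * (z\<^sup>2 + b * z + c) + \<alpha> * z + \<beta> = 0"
    and \<alpha>: "\<alpha> \<le> 0" and disc: "4 * c \<le> b\<^sup>2"
    and res: "\<beta>\<^sup>2 - b * \<alpha> * \<beta> + c * \<alpha>\<^sup>2 \<le> 0"
  shows "z \<in> \<real>"
proof (rule ccontr)
  assume "z \<notin> \<real>"
  define x y where "x = Re z" and "y = Im z"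
  have z: "z = Complex x y" by (simp add: x_def y_def)
  have y: "y \<noteq> 0" using \<open>z \<notin> \<real>\<close> by (simp add: y_def complex_is_Real_iff)
  \<comment> \<open>The real and imaginary parts of \<open>g\<close> at \<open>z\<close> are
    \<open>u\<close> and \<open>y * v\<close>; \<open>y * N\<close> is the imaginary part of
    \<open>\<alpha> * z + \<beta>\<close> times the conjugate of \<open>g\<close>.\<close>
  define u v where "u = x\<^sup>2 - y\<^sup>2 + b * x + c" and "v = 2 * x + b"
  define N where "N = \<alpha> * c - \<beta> * b - \<alpha> * (x\<^sup>2 + y\<^sup>2) - 2 * \<beta> * x"
  have re: "(x + k) * u - y\<^sup>2 * v + \<alpha> * x + \<beta> = 0"
    and im: "y * (u + (x + k) * v + \<alpha>) = 0"
    using root by (simp_all add: complex_eq_iff z u_def v_def power2_eq_square algebra_simps)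
  have im': "u + (x + k) * v + \<alpha> = 0" using im y by simp
  have "u\<^sup>2 + y\<^sup>2 * v\<^sup>2 + N = u * (u + (x + k) * v + \<alpha>) - v * ((x + k) * u - y\<^sup>2 * v + \<alpha> * x + \<beta>)"
    by (simp add: N_def u_def v_def power2_eq_square algebra_simps)
  then have sum0: "u\<^sup>2 + y\<^sup>2 * v\<^sup>2 + N = 0"
    using re im' by simp
  have N: "N \<ge> 0"
  proof (cases "\<alpha> = 0")
    case True
    then show ?thesis using res by (simp add: N_def)
  next
    case False
    \<comment> \<open>The first two squares add up to the squared modulus of
      \<open>\<alpha> * z + \<beta>\<close>.\<close>
    have "- \<alpha> * N = (\<alpha> * x + \<beta>)\<^sup>2 + (\<alpha> * y)\<^sup>2 - (\<beta>\<^sup>2 - b * \<alpha> * \<beta> + c * \<alpha>\<^sup>2)"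
      by (simp add: N_def power2_eq_square algebra_simps)
    also have "\<dots> \<ge> 0" using res by (smt (verit) zero_le_power2)
    finally show ?thesis using False \<alpha> by (simp add: mult_le_0_iff)
  qed
  have "0 \<le> y\<^sup>2 * v\<^sup>2" by simp
  with sum0 N have "u\<^sup>2 = 0" "y\<^sup>2 * v\<^sup>2 = 0" by (smt (verit) zero_le_power2)+
  \<comment> \<open>So \<open>g\<close> itself vanishes at the nonreal \<open>z\<close>, which
    \<open>disc\<close> forbids.\<close>
  then have "u = 0" "v = 0" using y by auto
  then have b: "b = - 2 * x" by (simp add: v_def)
  with \<open>u = 0\<close> have "c = x\<^sup>2 + y\<^sup>2" by (simp add: u_def power2_eq_square)
  with b have "4 * y\<^sup>2 \<le> 0" using disc by (simp add: power2_eq_square algebra_simps)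
  then show False using y by simp
qed

text \<open>
  Below, \<open>A\<close>, \<open>B\<close>, \<open>C\<close> stand for the complement degrees into \<open>I\<close> of the cover vertices
  \<open>a\<close>, \<open>b\<close>, \<open>c\<close>, and \<open>p\<close>, \<open>q\<close>, \<open>r\<close>, \<open>s\<close> for the numbers of common complement neighbours in
  \<open>I\<close> of \<open>{a, b}\<close>, \<open>{a, c}\<close>, \<open>{b, c}\<close>, \<open>{a, b, c}\<close>. Integrality matters: it gives \<open>s\<^sup>2 \<le> p * q * r\<close>.
\<close>
lemma cubic_root_real_no_edge:
  fixes z :: complex and A B C p q r s :: nat
  assumes root: "(z + A) * (z + B) * (z + C) - p * (z + C) - q * (z + B) - r * (z + A) + 2 * s = 0"
    and "s \<le> p" "s \<le> q" "s \<le> r"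
  shows "z \<in> \<real>"
proof (rule cubic_root_real[where k = C and b = "real A + real B" and c = "real A * real B - real p"
      and \<alpha> = "- (real q + real r)" and \<beta> = "2 * real s - real B * real q - real A * real r"])
  show "(z + complex_of_real (real C)) * (z\<^sup>2 + complex_of_real (real A + real B) * z
      + complex_of_real (real A * real B - real p)) + complex_of_real (- (real q + real r)) * z
      + complex_of_real (2 * real s - real B * real q - real A * real r) = 0"
    using root by (simp add: power2_eq_square algebra_simps)
  have "0 \<le> (real A - real B)\<^sup>2" by simp
  then show "4 * (real A * real B - real p) \<le> (real A + real B)\<^sup>2"
    by (simp add: power2_eq_square algebra_simps)
  \<comment> \<open>The resultant depends on \<open>A\<close> and \<open>B\<close> only through
    their difference \<open>D\<close>.\<close>
  define D a where "D = real A - real B" and "a = real q + real r"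
  have eq: "(2 * real s - real B * real q - real A * real r)\<^sup>2 - (real A + real B) * (- (real q + real r))
      * (2 * real s - real B * real q - real A * real r) + (real A * real B - real p) * (- (real q + real r))\<^sup>2
     = (D * q + 2 * s) * (2 * s - D * r) - p * a\<^sup>2" (is "?L = ?R")
    by (simp add: D_def a_def power2_eq_square algebra_simps)
  have "?R \<le> 0"
  proof (cases "s = 0")
    case True
    then have "?R = - (D\<^sup>2 * (q * r) + p * a\<^sup>2)" by (simp add: power2_eq_square algebra_simps)
    moreover have "0 \<le> D\<^sup>2 * (q * r)" "0 \<le> p * a\<^sup>2" by simp_all
    ultimately show ?thesis by linarith
  next
    case False
    then have pos: "real q * real r > 0" and "1 \<le> p" using assms by auto
    have "s * s \<le> q * r" using assms by (intro mult_mono) auto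
    also have "\<dots> \<le> p * (q * r)" using \<open>1 \<le> p\<close> by simp
    finally have "real s * real s \<le> real p * (real q * real r)"
      by (metis of_nat_le_iff of_nat_mult)
    then have 1: "real s * real s * a\<^sup>2 \<le> real p * (real q * real r) * a\<^sup>2"
      by (rule mult_right_mono) simp
    \<comment> \<open>Completing the square in \<open>D\<close>, with
      \<open>(q - r)\<^sup>2 + 4 * q * r = a\<^sup>2\<close>.\<close>
    have "real q * real r * ?R = real s * real s * a\<^sup>2 - real p * (real q * real r) * a\<^sup>2
        - (D * q * r - s * (real q - real r))\<^sup>2"
      by (simp add: a_def power2_eq_square algebra_simps)
    also have "\<dots> \<le> 0" using 1 by (smt (verit) zero_le_power2)
    finally show ?thesis by (rule nonpos_if_mult_nonpos) (use pos in simp)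
  qed
  then show "?L \<le> 0" using eq by simp
qed simp

text \<open>The edge joins the vertices of degrees \<open>A\<close> and \<open>B\<close>, and
  \<open>g = (z + A) * (z + B) + z\<close>. There is no \<open>p\<close> to dominate
  \<open>s\<^sup>2\<close>; the bounds \<open>q \<le> A\<close> and \<open>r \<le> B\<close> take
  over.\<close>

lemma cubic_root_real_one_edge:
  fixes z :: complex and A B C q r s :: nat
  assumes root: "(z + A) * (z + B) * (z + C) + z * (z + C) - q * (z + B) - r * (z + A) + s = 0"
    and "s \<le> q" "s \<le> r" "q \<le> A" "r \<le> B"
  shows "z \<in> \<real>"
proof (rule cubic_root_real[where k = C and b = "real A + real B + 1" and c = "real A * real B"
      and \<alpha> = "- (real q + real r)" and \<beta> = "real s - real B * real q - real A * real r"])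
  show "(z + complex_of_real (real C)) * (z\<^sup>2 + complex_of_real (real A + real B + 1) * z
      + complex_of_real (real A * real B)) + complex_of_real (- (real q + real r)) * z
      + complex_of_real (real s - real B * real q - real A * real r) = 0"
    using root by (simp add: power2_eq_square algebra_simps)
  have "0 \<le> (real A - real B)\<^sup>2 + 2 * (real A + real B) + 1" by simp
  then show "4 * (real A * real B) \<le> (real A + real B + 1)\<^sup>2"
    by (simp add: power2_eq_square algebra_simps)
  define D a m where "D = real A - real B" and "a = real q + real r" and "m = real q * real B + real r * real A"
  have eq: "(real s - real B * real q - real A * real r)\<^sup>2 - (real A + real B + 1) * (- (real q + real r))
      * (real s - real B * real q - real A * real r) + (real A * real B) * (- (real q + real r))\<^sup>2
     = (D * q + s) * (s - D * r) - a * (m - s)" (is "?L = ?R")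
    by (simp add: D_def a_def m_def power2_eq_square algebra_simps)
  have "?R \<le> 0"
  proof (cases "s = 0")
    case True
    then have "?R = - (D\<^sup>2 * (q * r) + a * m)" by (simp add: power2_eq_square algebra_simps)
    moreover have "0 \<le> D\<^sup>2 * (q * r)" "0 \<le> a * m" by (simp_all add: a_def m_def)
    ultimately show ?thesis by linarith
  next
    case False
    then have pos: "real q * real r > 0" and "1 \<le> A" "1 \<le> B" "1 \<le> q" "1 \<le> r" using assms by auto
    \<comment> \<open>Aim: \<open>a \<le> 4 * (m - s)\<close>, which follows from
      \<open>a \<le> m\<close> and \<open>2 * s \<le> m\<close>. Integrality enters through
      \<open>A\<close>, \<open>B\<close>, \<open>q\<close>, \<open>r\<close> being at least
      1.\<close>
    have "s \<le> B" "s \<le> A" using assms by auto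
    then have "s \<le> q * B" "s \<le> r * A" using \<open>1 \<le> q\<close> \<open>1 \<le> r\<close> by (metis mult_le_mono nat_mult_1)+
    moreover have "q \<le> q * B" "r \<le> r * A" using \<open>1 \<le> A\<close> \<open>1 \<le> B\<close> by auto
    ultimately have "q + r \<le> q * B + r * A" "2 * s \<le> q * B + r * A" by linarith+
    then have "a \<le> m" "2 * s \<le> m"
      unfolding a_def m_def by (metis of_nat_add of_nat_mult of_nat_le_iff of_nat_numeral)+
    moreover have "0 \<le> a" by (simp add: a_def)
    ultimately have am: "0 \<le> a" "a \<le> 4 * (m - s)" by auto
    have "s * s \<le> q * r" using assms by (intro mult_mono) auto
    then have "real s * real s \<le> real q * real r"
      by (metis of_nat_le_iff of_nat_mult)
    then have "real s * real s * a \<le> real q * real r * (4 * (m - s))"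
      by (rule mult_mono) (use am in simp_all)
    then have 1: "(real s * real s * a) * a \<le> real q * real r * (4 * (m - s)) * a"
      by (rule mult_right_mono) (rule am)
    \<comment> \<open>Again the square in \<open>D\<close> is completed; the factor 4 avoids
      fractions.\<close>
    have "(4 * (real q * real r)) * ?R = real s * real s * a * a - real q * real r * (4 * (m - s)) * a
        - (2 * D * q * r - s * (real q - real r))\<^sup>2"
      by (simp add: a_def power2_eq_square algebra_simps)
    also have "\<dots> \<le> 0" using 1 by (smt (verit) zero_le_power2)
    finally show ?thesis by (rule nonpos_if_mult_nonpos) (use pos in simp)
  qed
  then show "?L \<le> 0" using eq by simp
qed simp

text \<open>The general criterion applies because \<open>z * g'(z) = 2 * g(z) - b * z - 2 * c\<close>.\<close>
lemma cubic_root_real_deriv: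
  fixes z :: complex and k b c :: real
  assumes root: "(z + k) * (z\<^sup>2 + b * z + c) + z * (2 * z + b) = 0"
    and "0 \<le> b" "0 \<le> c" and disc: "4 * c \<le> b\<^sup>2"
  shows "z \<in> \<real>"
proof (rule cubic_root_real[where k = "k + 2" and b = b and c = c and \<alpha> = "- b" and \<beta> = "- 2 * c"])
  show "(z + complex_of_real (k + 2)) * (z\<^sup>2 + complex_of_real b * z + complex_of_real c)
      + complex_of_real (- b) * z + complex_of_real (- 2 * c) = 0"
    using root by (simp add: power2_eq_square algebra_simps)
  have "c * (4 * c - b\<^sup>2) \<le> 0" using assms by (simp add: mult_le_0_iff)
  then show "(- 2 * c)\<^sup>2 - b * (- b) * (- 2 * c) + c * (- b)\<^sup>2 \<le> 0"
    by (simp add: power2_eq_square algebra_simps)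
qed (use assms in auto)

lemma quadratic_root_real:
  fixes z :: complex and b c :: real
  assumes "z\<^sup>2 + b * z + c = 0" "4 * c \<le> b\<^sup>2"
  shows "z \<in> \<real>"
  by (rule cubic_root_real[where k = 0 and b = b and c = c and \<alpha> = 0 and \<beta> = 0]) (use assms in auto)

text \<open>The two edges meet in the vertex of degree \<open>A\<close>. For
  \<open>g = (z + B) * (z + C) - r\<close>, belonging to the other two vertices, the edge terms add
  up to \<open>z * g'(z)\<close>.\<close>

lemma cubic_root_real_two_edges:
  fixes z :: complex and A B C r :: nat
  assumes root: "(z + A) * (z + B) * (z + C) + z * (z + C) + z * (z + B) - r * (z + A) = 0"
    and "r \<le> B" "r \<le> C"
  shows "z \<in> \<real>"
proof (rule cubic_root_real_deriv[where k = A and b = "real B + real C" and c = "real B * real C - real r"])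
  show "(z + complex_of_real (real A)) * (z\<^sup>2 + complex_of_real (real B + real C) * z
      + complex_of_real (real B * real C - real r)) + z * (2 * z + complex_of_real (real B + real C)) = 0"
    using root by (simp add: power2_eq_square algebra_simps)
  have "r \<le> B * C" using assms by (cases B; cases C) auto
  then show "0 \<le> real B * real C - real r" by (metis diff_ge_0_iff_ge of_nat_le_iff of_nat_mult)
  have "0 \<le> (real B - real C)\<^sup>2" by simp
  then show "4 * (real B * real C - real r) \<le> (real B + real C)\<^sup>2"
    by (simp add: power2_eq_square algebra_simps)
qed simp

text \<open>With \<open>g = (z + A) * (z + B) + z\<close> the left-hand side is
  \<open>(z + C) * g + z * g'(z)\<close>.\<close>

lemma cubic_root_real_triangle:
  fixes z :: complex and A B C :: nat
  assumes root: "(z + A) * (z + B) * (z + C) + z * (3 * z + A + B + C + 1) = 0"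
  shows "z \<in> \<real>"
proof (rule cubic_root_real_deriv[where k = C and b = "real A + real B + 1" and c = "real A * real B"])
  show "(z + complex_of_real (real C)) * (z\<^sup>2 + complex_of_real (real A + real B + 1) * z
      + complex_of_real (real A * real B)) + z * (2 * z + complex_of_real (real A + real B + 1)) = 0"
    using root by (simp add: power2_eq_square algebra_simps)
  have "0 \<le> (real A - real B)\<^sup>2 + 2 * (real A + real B) + 1" by simp
  then show "4 * (real A * real B) \<le> (real A + real B + 1)\<^sup>2"
    by (simp add: power2_eq_square algebra_simps)
qed simp_all

section \<open>Generating function of independent partitions\<close>

text \<open>The \<sigma>-polynomial as a function on the complex numbers, freed from the chromatic
  number and available for every vertex subset, so that recursion on the vertex set is
  possible.\<close>

definition partition_gf :: "'a set set \<Rightarrow> 'a set \<Rightarrow> complex \<Rightarrow> complex" where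
  "partition_gf E A z = (\<Sum>P | partition_on A P \<and> (\<forall>B\<in>P. indep B E). z ^ card P)"

lemma finite_indep_partitions: "finite A \<Longrightarrow> finite {P. partition_on A P \<and> (\<forall>B\<in>P. indep B E)}"
  by (rule finite_subset[OF _ finitely_many_partition_on]) auto

text \<open>Numbering the blocks gives a proper colouring. Hence the lower summation bound in
  \<open>sigma_poly\<close> cuts off only zero terms.\<close>

lemma chromatic_number_le:
  assumes "finite P" "partition_on V P" "\<forall>B\<in>P. indep B E" "E \<subseteq> [V]\<^bsup>2\<^esup>"
  shows "chromatic_number V E \<le> card P"
proof -
  obtain h where h: "inj_on h P" "h ` P = {..<card P}"
    using \<open>finite P\<close> by (metis bij_betw_def ex_bij_betw_finite_nat atLeast0LessThan)
  define blk where "blk v = (THE B. B \<in> P \<and> v \<in> B)" for v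
  have ex1: "\<exists>!B. B \<in> P \<and> v \<in> B" if "v \<in> V" for v
    using that assms(2) by (auto simp: partition_on_def disjoint_def)
  have blk: "blk v \<in> P" "v \<in> blk v" if "v \<in> V" for v
    using theI'[OF ex1[OF that]] by (auto simp: blk_def)
  have "proper_colouring V E (card P) (h \<circ> blk)"
    unfolding proper_colouring_def
  proof safe
    fix v assume "v \<in> V"
    then show "(h \<circ> blk) v < card P" using blk h by force
  next
    fix u v assume uv: "u \<in> V" "v \<in> V" "{u, v} \<in> E" "(h \<circ> blk) u = (h \<circ> blk) v"
    then have "blk u = blk v" using blk h by (auto dest: inj_onD)
    moreover have "u \<noteq> v" using uv(3) assms(4) by (auto simp: nsets_def)
    moreover have "indep (blk u) E" "u \<in> blk u" "v \<in> blk v" using uv(1,2) assms(3) blk by blast+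
    ultimately show False using uv(3) unfolding indep_def by simp
  qed
  then show ?thesis unfolding chromatic_number_def by (intro Least_le) auto
qed

lemma poly_sigma_poly:
  assumes "finite_simple_graph V E"
  shows "poly (map_poly complex_of_real (sigma_poly V E)) z = partition_gf E V z"
proof -
  let ?M = "{P. partition_on V P \<and> (\<forall>B\<in>P. indep B E)}"
  have fin: "finite V" and E: "E \<subseteq> [V]\<^bsup>2\<^esup>" using assms by (auto simp: finite_simple_graph_def)
  have "map_poly complex_of_real (sigma_poly V E) =
      (\<Sum>i = chromatic_number V E..card V. monom (of_nat (card (indep_partitions V E i))) i)"
    unfolding sigma_poly_def by (rule poly_eqI) (auto simp: coeff_map_poly coeff_sum intro!: sum.cong)
  then have "poly (map_poly complex_of_real (sigma_poly V E)) z =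
      (\<Sum>i = chromatic_number V E..card V. of_nat (card (indep_partitions V E i)) * z ^ i)"
    by (simp add: poly_sum poly_monom)
  also have "\<dots> = (\<Sum>i = chromatic_number V E..card V. \<Sum>P\<in>{P\<in>?M. card P = i}. z ^ card P)"
  proof (rule sum.cong[OF refl])
    fix i
    have "{P\<in>?M. card P = i} = indep_partitions V E i" by (auto simp: indep_partitions_def)
    then show "of_nat (card (indep_partitions V E i)) * z ^ i = (\<Sum>P\<in>{P\<in>?M. card P = i}. z ^ card P)"
      by (simp add: indep_partitions_def)
  qed
  also have "\<dots> = partition_gf E V z"
    unfolding partition_gf_def
  proof (rule sum.group)
    show "finite ?M" using fin by (rule finite_indep_partitions)
    show "card ` ?M \<subseteq> {chromatic_number V E..card V}"
    proof safe
      fix P assume P: "partition_on V P" "\<forall>B\<in>P. indep B E"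
      have "finite P" using finite_elements[OF fin P(1)] .
      then have "chromatic_number V E \<le> card P" using P E by (rule chromatic_number_le)
      moreover have "card P \<le> card V"
      proof (rule surj_card_le[OF fin, where f = "\<lambda>v. THE B. B \<in> P \<and> v \<in> B"], rule subsetI)
        fix B assume "B \<in> P"
        then have "B \<noteq> {}" "B \<subseteq> V" using P(1) by (auto simp: partition_on_def)
        then obtain v where v: "v \<in> B" "v \<in> V" by blast
        moreover have "(THE B. B \<in> P \<and> v \<in> B) = B"
          using v \<open>B \<in> P\<close> P(1) by (intro the_equality) (auto simp: partition_on_def disjoint_def)
        ultimately show "B \<in> (\<lambda>v. THE B. B \<in> P \<and> v \<in> B) ` V"
          by (intro image_eqI[where x = v]) simp_all
      qed
      ultimately show "card P \<in> {chromatic_number V E..card V}" by simp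
    qed
  qed simp
  finally show ?thesis .
qed

text \<open>Classify the partitions by the block \<open>insert a T\<close> of \<open>a\<close> and
  delete that block; it accounts for the factor \<open>z\<close>.\<close>

lemma partition_gf_insert:
  assumes "finite A" "a \<notin> A"
  shows "partition_gf E (insert a A) z =
    (\<Sum>T | T \<subseteq> A \<and> indep (insert a T) E. z * partition_gf E (A - T) z)"
proof -
  let ?M = "\<lambda>A. {P. partition_on A P \<and> (\<forall>B\<in>P. indep B E)}"
  let ?S = "Sigma {T. T \<subseteq> A \<and> indep (insert a T) E} (\<lambda>T. ?M (A - T))"
  have new: "insert a T \<notin> P" if "P \<in> ?M (A - T)" for T P
    using that assms(2) by (auto simp: partition_on_def)
  have part_iff: "partition_on (insert a A) (insert (insert a T) P)"
    if "P \<in> ?M (A - T)" "T \<subseteq> A" for T P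
  proof -
    have "disjnt (insert a T) (\<Union>P)" using that assms(2) by (auto simp: partition_on_def disjnt_def)
    moreover have "insert a A - insert a T = A - T" using assms(2) by auto
    ultimately show ?thesis using that by (subst partition_on_insert) auto
  qed
  have "partition_gf E (insert a A) z = (\<Sum>(T, P)\<in>?S. z * z ^ card P)"
    unfolding partition_gf_def
  \<comment> \<open>The union is over the single block containing \<open>a\<close>; this form names
    that block without a choice operator.\<close>
  proof (rule sum.reindex_bij_witness[where i = "\<lambda>(T, P). insert (insert a T) P"
        and j = "\<lambda>P. (A \<inter> \<Union>{B\<in>P. a \<in> B}, {B\<in>P. a \<notin> B})"])
    fix P assume "P \<in> ?M (insert a A)"
    then have P: "partition_on (insert a A) P" "\<forall>B\<in>P. indep B E" by auto
    have Un: "\<Union>P = insert a A" using partition_onD1[OF P(1)] by simp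
    then obtain B where B: "B \<in> P" "a \<in> B" by blast
    have uniq: "B' = B" if "B' \<in> P" "a \<in> B'" for B'
      using that B disjointD[OF partition_onD2[OF P(1)], of B B'] by blast
    have 1: "{B\<in>P. a \<in> B} = {B}" and 2: "{B\<in>P. a \<notin> B} = P - {B}" using B uniq by blast+
    have "B \<subseteq> insert a A" using Un B by blast
    then have 3: "insert a (A \<inter> B) = B" using B by auto
    have 4: "(insert (insert a (A \<inter> B)) (P - {B})) = P" using 3 B by auto
    have "disjnt B (\<Union>(P - {B}))" using disjointD[OF partition_onD2[OF P(1)], of B] B
      unfolding disjnt_def by blast
    then have "partition_on (insert a A - B) (P - {B})"
      using P(1) B partition_on_insert[of B "P - {B}" "insert a A"] by (simp add: insert_absorb)
    moreover have "insert a A - B = A - A \<inter> B" using B assms(2) by auto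
    ultimately have 5: "partition_on (A - A \<inter> B) (P - {B})" by simp
    show "(case (A \<inter> \<Union>{B\<in>P. a \<in> B}, {B\<in>P. a \<notin> B}) of (T, P) \<Rightarrow> insert (insert a T) P) = P"
      unfolding 1 2 using 4 by simp
    show "(A \<inter> \<Union>{B\<in>P. a \<in> B}, {B\<in>P. a \<notin> B}) \<in> ?S"
      unfolding 1 2 using 3 5 B P(2) by auto
    have "finite P" using P(1) assms(1) by (meson finite_elements finite_insert)
    then have "card P = Suc (card (P - {B}))" using B by (metis card_Suc_Diff1)
    then show "(case (A \<inter> \<Union>{B\<in>P. a \<in> B}, {B\<in>P. a \<notin> B}) of (T, P) \<Rightarrow> z * z ^ card P) = z ^ card P"
      unfolding 1 2 by simp
  next
    fix x assume "x \<in> ?S"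
    then obtain T P where x: "x = (T, P)" "T \<subseteq> A" "indep (insert a T) E" "P \<in> ?M (A - T)" by auto
    have "a \<notin> B" if "B \<in> P" for B using that x(4) assms(2) by (auto simp: partition_on_def)
    then have "{B \<in> insert (insert a T) P. a \<in> B} = {insert a T}"
      "{B \<in> insert (insert a T) P. a \<notin> B} = P" by auto
    then show "(A \<inter> \<Union>{B \<in> case x of (T, P) \<Rightarrow> insert (insert a T) P. a \<in> B},
        {B \<in> case x of (T, P) \<Rightarrow> insert (insert a T) P. a \<notin> B}) = x"
      using x(1,2) assms(2) by auto
    show "(case x of (T, P) \<Rightarrow> insert (insert a T) P) \<in> ?M (insert a A)"
      using x part_iff by auto
  qed
  also have "\<dots> = (\<Sum>T | T \<subseteq> A \<and> indep (insert a T) E. \<Sum>P\<in>?M (A - T). z * z ^ card P)"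
    using assms(1) by (subst sum.Sigma) (auto intro!: finite_indep_partitions)
  finally show ?thesis by (simp add: partition_gf_def sum_distrib_left)
qed

section \<open>Cancelling the clique: the residual and its recursion\<close>

text \<open>Neighbours in the complement, although \<open>E\<close> is the edge set of
  \<open>G\<close>: these are the vertices of \<open>I\<close> that may share an independent block
  with \<open>T\<close>.\<close>

definition common_nbrs :: "'a set set \<Rightarrow> 'a set \<Rightarrow> 'a set \<Rightarrow> 'a set" where
  "common_nbrs E T I = {v\<in>I. \<forall>x\<in>T. {x, v} \<notin> E}"

text \<open>The block of \<open>a\<close> either avoids the clique or contains exactly one
  \<open>v\<close> of it, and \<open>v\<close> fits exactly when it is a complement neighbour of all
  of \<open>insert a T\<close>.\<close>

lemma sum_blocks_split:
  fixes f :: "'a set \<Rightarrow> complex"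
  assumes fin: "finite S" "finite I" and disj: "S \<inter> I = {}" and a: "a \<notin> I"
    and cl: "clique I E"
  shows "(\<Sum>T | T \<subseteq> S \<union> I \<and> indep (insert a T) E. f T) =
    (\<Sum>T | T \<subseteq> S \<and> indep (insert a T) E. f T + (\<Sum>v\<in>common_nbrs E (insert a T) I. f (insert v T)))"
proof -
  let ?K = "{T. T \<subseteq> S \<and> indep (insert a T) E}"
  let ?N = "\<lambda>T. common_nbrs E (insert a T) I"
  let ?S = "Sigma ?K ?N" and ?g = "\<lambda>(T, v). insert v T"
  have indep_iff: "indep (insert a (insert v T)) E \<longleftrightarrow> indep (insert a T) E \<and> v \<in> ?N T"
    if "T \<subseteq> S" "v \<in> I" for T v
    using that disj a by (auto simp: indep_def common_nbrs_def insert_commute)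
  have finK: "finite ?K" using fin by auto
  have finN: "finite (?N T)" for T using fin by (simp add: common_nbrs_def)
  have eq: "{T. T \<subseteq> S \<union> I \<and> indep (insert a T) E} = ?K \<union> ?g ` ?S"
  proof (intro equalityI subsetI)
    fix T assume "T \<in> {T. T \<subseteq> S \<union> I \<and> indep (insert a T) E}"
    then have T: "T \<subseteq> S \<union> I" "indep (insert a T) E" by auto
    show "T \<in> ?K \<union> ?g ` ?S"
    proof (cases "T \<inter> I = {}")
      case True
      then show ?thesis using T by auto
    next
      case False
      then obtain v where v: "v \<in> T" "v \<in> I" by auto
      have "w = v" if "w \<in> T" "w \<in> I" for w
        using that v T(2) cl unfolding indep_def clique_def by (metis insertCI)
      then have "T - {v} \<subseteq> S" using T(1) by blast
      moreover have "T = insert v (T - {v})" using v by auto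
      ultimately show ?thesis using indep_iff[of "T - {v}" v] v T(2)
        by (intro UnI2 image_eqI[where x = "(T - {v}, v)"]) auto
    qed
  next
    fix T assume "T \<in> ?K \<union> ?g ` ?S"
    then show "T \<in> {T. T \<subseteq> S \<union> I \<and> indep (insert a T) E}"
      using indep_iff by (auto simp: common_nbrs_def)
  qed
  have inj: "inj_on ?g ?S"
  proof (rule inj_onI, clarsimp)
    fix T v T' v' assume *: "T \<subseteq> S" "T' \<subseteq> S" "v \<in> ?N T" "v' \<in> ?N T'" "insert v T = insert v' T'"
    then have "v \<in> I" "v' \<in> I" by (simp_all add: common_nbrs_def)
    then have eqs: "T = insert v T \<inter> S" "T' = insert v' T' \<inter> S" "{v} = insert v T \<inter> I" "{v'} = insert v' T' \<inter> I"
      using *(1,2) disj by auto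
    have "T = T'" by (rule trans[OF eqs(1)[unfolded *(5)] eqs(2)[symmetric]])
    moreover have "{v} = {v'}" by (rule trans[OF eqs(3)[unfolded *(5)] eqs(4)[symmetric]])
    ultimately show "T = T' \<and> v = v'" by simp
  qed
  have "sum f (?K \<union> ?g ` ?S) = sum f ?K + sum f (?g ` ?S)"
    using finK finN disj by (intro sum.union_disjoint) (auto simp: common_nbrs_def)
  also have "sum f (?g ` ?S) = sum (f \<circ> ?g) ?S"
    by (rule sum.reindex[OF inj])
  also have "\<dots> = (\<Sum>T\<in>?K. \<Sum>v\<in>?N T. f (insert v T))"
    using finK finN by (simp add: sum.Sigma case_prod_unfold comp_def)
  finally show ?thesis unfolding eq by (simp add: sum.distrib)
qed

text \<open>
  For \<open>z = 0\<close> the quotient is a junk value; otherwise every block meeting \<open>I\<close> contributes a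
  factor \<open>z\<close> that is cancelled here, so the residual counts only blocks inside \<open>S\<close>.
\<close>
definition residual :: "'a set set \<Rightarrow> 'a set \<Rightarrow> 'a set \<Rightarrow> complex \<Rightarrow> complex" where
  "residual E S I z = partition_gf E (S \<union> I) z / z ^ card I"

text \<open>A block that uses some \<open>v\<close> of \<open>I\<close> carries no \<open>z\<close>
  here: deleting \<open>v\<close> lowers the exponent \<open>card I\<close> by one, which absorbs
  the factor of the block. Summing over \<open>Pow S\<close> lets a concrete \<open>S\<close> be
  enumerated.\<close>

lemma residual_insert:
  assumes fin: "finite S" "finite I" and disj: "S \<inter> I = {}" and a: "a \<notin> S" "a \<notin> I"
    and cl: "clique I E" and z: "z \<noteq> 0"
  shows "residual E (insert a S) I z =
    (\<Sum>T\<in>Pow S. if indep (insert a T) E then z * residual E (S - T) I z +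
       (\<Sum>v\<in>common_nbrs E (insert a T) I. residual E (S - T) (I - {v}) z) else 0)"
proof -
  let ?N = "\<lambda>T. common_nbrs E (insert a T) I"
  have 1: "z * partition_gf E (S \<union> I - T) z / z ^ card I = z * residual E (S - T) I z"
    if "T \<subseteq> S" for T
  proof -
    have "S \<union> I - T = (S - T) \<union> I" using that disj by auto
    then show ?thesis by (simp add: residual_def)
  qed
  have 2: "z * partition_gf E (S \<union> I - insert v T) z / z ^ card I = residual E (S - T) (I - {v}) z"
    if "T \<subseteq> S" "v \<in> I" for T v
  proof -
    have "S \<union> I - insert v T = (S - T) \<union> (I - {v})" using that disj by auto
    moreover have "z ^ card I = z * z ^ card (I - {v})"
      using that fin by (metis card_Suc_Diff1 power_Suc)
    ultimately show ?thesis using z by (simp add: residual_def)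
  qed
  have "residual E (insert a S) I z =
    (\<Sum>T | T \<subseteq> S \<union> I \<and> indep (insert a T) E. z * partition_gf E (S \<union> I - T) z / z ^ card I)"
    unfolding residual_def using partition_gf_insert[of "S \<union> I" a E z] fin a
    by (simp add: sum_divide_distrib)
  also have "\<dots> = (\<Sum>T | T \<subseteq> S \<and> indep (insert a T) E. z * residual E (S - T) I z +
       (\<Sum>v\<in>?N T. residual E (S - T) (I - {v}) z))"
    unfolding sum_blocks_split[OF fin disj a(2) cl]
    using 1 2 by (intro sum.cong arg_cong2[where f = "(+)"]) (auto simp: common_nbrs_def)
  also have "\<dots> = (\<Sum>T\<in>Pow S. if indep (insert a T) E then z * residual E (S - T) I z +
       (\<Sum>v\<in>?N T. residual E (S - T) (I - {v}) z) else 0)"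
    using fin by (subst sum.inter_filter[symmetric]) (auto intro!: sum.cong)
  finally show ?thesis .
qed

lemma residual_empty:
  assumes "finite I" "clique I E" "z \<noteq> 0"
  shows "residual E {} I z = 1"
  using assms
proof (induction I rule: finite_induct)
  case empty
  then show ?case by (simp add: residual_def partition_gf_def partition_on_empty conj_commute[of "_ = {}"] cong: conj_cong)
next
  case (insert a I)
  have "clique I E" and nb: "common_nbrs E {a} I = {}"
    using insert.prems(1) insert.hyps by (auto simp: clique_def common_nbrs_def)
  \<comment> \<open>The clique vertex \<open>a\<close> is moved to the cover side so that the
    recursion applies; having no complement neighbour in \<open>I\<close>, it forms a block of its
    own.\<close>
  moreover have "residual E {} (insert a I) z = residual E {a} I z / z"
    using insert.hyps by (simp add: residual_def)
  moreover have "residual E {a} I z = z * residual E {} I z"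
    using residual_insert[of "{}" I a E z] insert nb \<open>clique I E\<close> by (simp add: indep_def)
  ultimately show ?case using insert by simp
qed

section \<open>Residuals of at most three cover vertices\<close>

text \<open>The correction is an \<open>of_bool\<close> in the complex numbers: subtraction is not
  truncated, and summing over \<open>v\<close> turns it into the count for a larger vertex
  set.\<close>

lemma card_common_nbrs_remove:
  assumes "finite I"
  shows "(of_nat (card (common_nbrs E T (I - {v}))) :: complex) =
    of_nat (card (common_nbrs E T I)) - of_bool (v \<in> common_nbrs E T I)"
proof -
  let ?N = "common_nbrs E T I"
  have eq: "common_nbrs E T (I - {v}) = ?N - {v}" by (auto simp: common_nbrs_def)
  show ?thesis
  proof (cases "v \<in> ?N")
    case True
    have "finite ?N" using assms by (simp add: common_nbrs_def)
    then have "card ?N = Suc (card (?N - {v}))" using True by (rule card.remove)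
    then have "(of_nat (card ?N) :: complex) = of_nat (card (?N - {v})) + 1"
      by (simp only: of_nat_Suc add.commute)
    then show ?thesis using True unfolding eq by simp
  next
    case False
    then show ?thesis by (simp add: eq)
  qed
qed

lemma sum_of_bool_common_nbrs:
  assumes "finite I"
  shows "(\<Sum>v\<in>common_nbrs E S I. of_bool (v \<in> common_nbrs E T I)) =
    (of_nat (card (common_nbrs E (S \<union> T) I)) :: complex)"
proof -
  have "common_nbrs E S I \<inter> common_nbrs E T I = common_nbrs E (S \<union> T) I"
    by (auto simp: common_nbrs_def)
  moreover have "finite (common_nbrs E S I)" using assms by (simp add: common_nbrs_def)
  ultimately show ?thesis by (simp add: sum.If_cases of_bool_def Int_def)
qed

lemma residual_singleton:
  assumes "finite I" "c \<notin> I" "clique I E" "z \<noteq> 0"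
  shows "residual E {c} I z = z + card (common_nbrs E {c} I)"
proof -
  have "clique (I - {v}) E" for v using assms by (auto simp: clique_def)
  then show ?thesis
    using residual_insert[of "{}" I c E z] assms by (simp add: residual_empty indep_def)
qed

text \<open>The product lets \<open>b\<close> and \<open>c\<close> choose independently between a
  block without \<open>I\<close> and a complement neighbour in \<open>I\<close>;
  \<open>d {b, c}\<close> counts the collisions. If \<open>b\<close> and \<open>c\<close> may share
  a block, the blocks \<open>{b, c, v}\<close> make up for the collisions and only
  \<open>{b, c}\<close> remains, with weight \<open>z\<close>.\<close>

lemma residual_pair:
  fixes E :: "'a set set"
  assumes "finite I" "b \<notin> I" "c \<notin> I" "b \<noteq> c" "clique I E" "z \<noteq> 0"
  defines "d \<equiv> \<lambda>T. of_nat (card (common_nbrs E T I)) :: complex"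
  shows "residual E {b, c} I z =
    (z + d {b}) * (z + d {c}) + (if {b, c} \<notin> E then z else - d {b, c})"
proof -
  let ?N = "\<lambda>T. common_nbrs E T I"
  have cl: "clique (I - {v}) E" for v using assms by (auto simp: clique_def)
  have i: "indep {b} E" "indep {b, c} E \<longleftrightarrow> {b, c} \<notin> E"
    using assms by (auto simp: indep_def insert_commute)
  have P: "Pow {c} = {{}, {c}}" by auto
  have "residual E {b, c} I z =
    z * residual E {c} I z + (\<Sum>v\<in>?N {b}. residual E {c} (I - {v}) z) +
    (if {b, c} \<notin> E then z * residual E {} I z + (\<Sum>v\<in>?N {b, c}. residual E {} (I - {v}) z) else 0)"
    using residual_insert[of "{c}" I b E z] assms(1-6) by (simp add: P i)
  moreover have "residual E {} I z = 1" "residual E {} (I - {v}) z = 1" for v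
    using assms(1,6) by (simp_all add: residual_empty assms(5) cl)
  moreover have "residual E {c} I z = z + d {c}"
    using residual_singleton[OF assms(1,3,5,6)] by (simp add: d_def)
  moreover have "residual E {c} (I - {v}) z = z + d {c} - of_bool (v \<in> ?N {c})" for v
    using residual_singleton[of "I - {v}" c E z] assms(1,3,6) by (simp add: cl d_def card_common_nbrs_remove)
  moreover have "(\<Sum>v\<in>?N {b}. of_bool (v \<in> ?N {c})) = d {b, c}"
    unfolding sum_of_bool_common_nbrs[OF assms(1)] by (simp add: d_def insert_commute)
  ultimately show ?thesis
    by (simp add: sum.distrib sum_subtractf) (simp add: d_def algebra_simps)
qed

text \<open>Inclusion-exclusion over collisions, where 2 is the coefficient of a triple collision. A
  complement edge \<open>{a, b}\<close> adds \<open>d {a, b} * (z + d {c}) - d {a, b, c}\<close>,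
  because \<open>c\<close> must avoid the vertex used by \<open>a\<close> and \<open>b\<close>; so
  each edge lowers the 2 by one. For a triangle the blocks \<open>{a, b, c, v}\<close> cancel the
  resulting -1.\<close>

lemma residual_triple:
  fixes E :: "'a set set"
  assumes "finite I" "a \<notin> I" "b \<notin> I" "c \<notin> I" "a \<noteq> b" "a \<noteq> c" "b \<noteq> c" "clique I E" "z \<noteq> 0"
  defines "d \<equiv> \<lambda>T. of_nat (card (common_nbrs E T I)) :: complex"
  shows "residual E {a, b, c} I z =
    (z + d {a}) * (z + d {b}) * (z + d {c}) +
    (if {a, b} \<notin> E then z else - d {a, b}) * (z + d {c}) +
    (if {a, c} \<notin> E then z else - d {a, c}) * (z + d {b}) +
    (if {b, c} \<notin> E then z else - d {b, c}) * (z + d {a}) +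
    (if {a, b} \<notin> E \<and> {a, c} \<notin> E \<and> {b, c} \<notin> E then z
     else (2 - of_bool ({a, b} \<notin> E) - of_bool ({a, c} \<notin> E) - of_bool ({b, c} \<notin> E)) * d {a, b, c})"
proof -
  let ?N = "\<lambda>T. common_nbrs E T I"
  have cl: "clique (I - {v}) E" for v using assms by (auto simp: clique_def)
  have i: "indep {a} E" "indep {a, b} E \<longleftrightarrow> {a, b} \<notin> E" "indep {a, c} E \<longleftrightarrow> {a, c} \<notin> E"
    "indep {a, b, c} E \<longleftrightarrow> {a, b} \<notin> E \<and> {a, c} \<notin> E \<and> {b, c} \<notin> E"
    using assms(5-7) by (auto simp: indep_def insert_commute)
  have D: "{b, c} - {b} = {c}" "{b, c} - {c} = {b}" using assms(7) by auto
  have P: "Pow {b, c} = {{}, {b}, {c}, {b, c}}" by auto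
  have ne: "{b} \<noteq> {c}" "{b} \<noteq> {b, c}" "{c} \<noteq> {b, c}" using assms(7) by auto
  have r0: "residual E {} I z = 1" "residual E {} (I - {v}) z = 1" for v
    using assms(1,9) by (simp_all add: residual_empty assms(8) cl)
  have r1: "residual E {x} I z = z + d {x}"
    "residual E {x} (I - {v}) z = z + d {x} - of_bool (v \<in> ?N {x})" if "x \<notin> I" for x v
    using residual_singleton[of I x E z] residual_singleton[of "I - {v}" x E z] assms(1,8,9) that
    by (simp_all add: cl d_def card_common_nbrs_remove)
  have r2: "residual E {b, c} I z = (z + d {b}) * (z + d {c}) + (if {b, c} \<notin> E then z else - d {b, c})"
    using residual_pair[OF assms(1,3,4,7,8,9)] by (simp add: d_def)
  have prod: "of_bool (v \<in> ?N {b}) * of_bool (v \<in> ?N {c}) = (of_bool (v \<in> ?N {b, c}) :: complex)" for v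
    by (auto simp: common_nbrs_def)
  have r2': "residual E {b, c} (I - {v}) z =
      (z + d {b}) * (z + d {c}) - of_bool (v \<in> ?N {b}) * (z + d {c})
        - of_bool (v \<in> ?N {c}) * (z + d {b}) + of_bool (v \<in> ?N {b, c})
        + (if {b, c} \<notin> E then z else of_bool (v \<in> ?N {b, c}) - d {b, c})" (is "_ = ?R") for v
  proof -
    have "residual E {b, c} (I - {v}) z =
      (z + (d {b} - of_bool (v \<in> ?N {b}))) * (z + (d {c} - of_bool (v \<in> ?N {c})))
        + (if {b, c} \<notin> E then z else - (d {b, c} - of_bool (v \<in> ?N {b, c})))"
      using residual_pair[of "I - {v}" b c E z] assms(1,3,4,7,9)
      by (simp add: cl card_common_nbrs_remove d_def)
    also have "\<dots> = ?R" unfolding prod[symmetric] by (simp add: algebra_simps)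
    finally show ?thesis .
  qed
  have s1: "(\<Sum>v\<in>?N {a}. of_bool (v \<in> ?N T)) = d (insert a T)" for T
    unfolding sum_of_bool_common_nbrs[OF assms(1)] by (simp add: d_def)
  have s2: "(\<Sum>v\<in>?N {a, b}. of_bool (v \<in> ?N {c})) = d {a, b, c}"
    "(\<Sum>v\<in>?N {a, c}. of_bool (v \<in> ?N {b})) = d {a, b, c}"
    unfolding sum_of_bool_common_nbrs[OF assms(1)] by (simp_all add: d_def insert_commute)
  have card: "of_nat (card (?N T)) = d T" for T by (simp add: d_def)
  have "residual E {a, b, c} I z =
    z * residual E {b, c} I z + (\<Sum>v\<in>?N {a}. residual E {b, c} (I - {v}) z) +
    ((if {a, b} \<notin> E then z * residual E {c} I z + (\<Sum>v\<in>?N {a, b}. residual E {c} (I - {v}) z) else 0) +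
    ((if {a, c} \<notin> E then z * residual E {b} I z + (\<Sum>v\<in>?N {a, c}. residual E {b} (I - {v}) z) else 0) +
    (if {a, b} \<notin> E \<and> {a, c} \<notin> E \<and> {b, c} \<notin> E then z * residual E {} I z
       + (\<Sum>v\<in>?N {a, b, c}. residual E {} (I - {v}) z) else 0)))"
    using residual_insert[of "{b, c}" I a E z] assms(1-9) by (simp add: P D ne i)
  also have "(\<Sum>v\<in>?N {a}. residual E {b, c} (I - {v}) z) =
    d {a} * (z + d {b}) * (z + d {c}) - d {a, b} * (z + d {c}) - d {a, c} * (z + d {b}) + d {a, b, c}
    + (if {b, c} \<notin> E then d {a} * z else d {a, b, c} - d {a} * d {b, c})"
    unfolding r2'
    by (simp add: sum.distrib sum_subtractf sum_distrib_right[symmetric] s1 card)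
  also have "(\<Sum>v\<in>?N {a, b}. residual E {c} (I - {v}) z) = d {a, b} * (z + d {c}) - d {a, b, c}"
    unfolding r1(2)[OF assms(4)] sum_subtractf s2 by (simp add: card)
  also have "(\<Sum>v\<in>?N {a, c}. residual E {b} (I - {v}) z) = d {a, c} * (z + d {b}) - d {a, b, c}"
    unfolding r1(2)[OF assms(3)] sum_subtractf s2 by (simp add: card)
  also have "(\<Sum>v\<in>?N {a, b, c}. residual E {} (I - {v}) z) = d {a, b, c}"
    unfolding r0 by (simp add: card)
  finally show ?thesis
    unfolding r0 r1(1)[OF assms(3)] r1(1)[OF assms(4)] r2
    by (cases "{a, b} \<in> E"; cases "{a, c} \<in> E"; cases "{b, c} \<in> E") (simp_all add: algebra_simps)
qed

section \<open>Case analysis and conclusion\<close>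

text \<open>Up to permuting the cover vertices only the number of complement edges counts. The
  one-edge lemma takes the two ends of the edge first, the two-edge lemma the common end.\<close>

lemma cubic_root_real_residual:
  fixes z :: complex and A B C p q r s :: nat
  assumes root: "(z + A) * (z + B) * (z + C) +
      (if u then z else - of_nat p) * (z + C) +
      (if v then z else - of_nat q) * (z + B) +
      (if w then z else - of_nat r) * (z + A) +
      (if u \<and> v \<and> w then z else (2 - of_bool u - of_bool v - of_bool w) * of_nat s) = 0"
    and le: "s \<le> p" "s \<le> q" "s \<le> r" "p \<le> A" "p \<le> B" "q \<le> A" "q \<le> C" "r \<le> B" "r \<le> C"
  shows "z \<in> \<real>"
proof -
  consider "\<not> u" "\<not> v" "\<not> w" | "u" "\<not> v" "\<not> w" | "\<not> u" "v" "\<not> w" | "\<not> u" "\<not> v" "w"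
    | "u" "v" "\<not> w" | "u" "\<not> v" "w" | "\<not> u" "v" "w" | "u" "v" "w" by blast
  then show ?thesis
  proof cases
    case 1
    show ?thesis by (rule cubic_root_real_no_edge[of z A B C p q r s]) (use root le 1 in \<open>simp_all add: algebra_simps\<close>)
  next
    case 2
    show ?thesis by (rule cubic_root_real_one_edge[of z A B C q r s]) (use root le 2 in \<open>simp_all add: algebra_simps\<close>)
  next
    case 3
    show ?thesis by (rule cubic_root_real_one_edge[of z A C B p r s]) (use root le 3 in \<open>simp_all add: algebra_simps\<close>)
  next
    case 4
    show ?thesis by (rule cubic_root_real_one_edge[of z B C A p q s]) (use root le 4 in \<open>simp_all add: algebra_simps\<close>)
  next
    case 5
    show ?thesis by (rule cubic_root_real_two_edges[of z A B C r]) (use root le 5 in \<open>simp_all add: algebra_simps\<close>)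
  next
    case 6
    show ?thesis by (rule cubic_root_real_two_edges[of z B A C q]) (use root le 6 in \<open>simp_all add: algebra_simps\<close>)
  next
    case 7
    show ?thesis by (rule cubic_root_real_two_edges[of z C A B p]) (use root le 7 in \<open>simp_all add: algebra_simps\<close>)
  next
    case 8
    show ?thesis by (rule cubic_root_real_triangle[of z A B C]) (use root 8 in \<open>simp add: algebra_simps\<close>)
  qed
qed

lemma residual_root_real:
  assumes fin: "finite S" "finite I" and "S \<inter> I = {}" "card S \<le> 3" "clique I E"
    and "z \<noteq> 0" "residual E S I z = 0"
  shows "z \<in> \<real>"
proof -
  have mono: "card (common_nbrs E T I) \<le> card (common_nbrs E T' I)" if "T' \<subseteq> T" for T T'
    using that fin by (intro card_mono) (auto simp: common_nbrs_def)
  consider "card S = 0" | "card S = 1" | "card S = 2" | "card S = 3" using assms(4) by linarith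
  then show ?thesis
  proof cases
    case 1
    then show ?thesis using assms by (simp add: residual_empty)
  next
    case 2
    then obtain c where "S = {c}" by (auto simp: card_1_singleton_iff)
    then have "z = - of_nat (card (common_nbrs E {c} I))"
      using assms by (simp add: residual_singleton add_eq_0_iff2)
    then show ?thesis by simp
  next
    case 3
    then obtain b c where S: "S = {b, c}" "b \<noteq> c" by (auto simp: card_2_iff)
    let ?B = "real (card (common_nbrs E {b} I))" and ?C = "real (card (common_nbrs E {c} I))"
    let ?r = "real (card (common_nbrs E {b, c} I))"
    have root: "(z + ?B) * (z + ?C) + (if {b, c} \<notin> E then z else - ?r) = 0"
      using assms S residual_pair[of I b c E z] by (auto split: if_splits)
    have sq: "0 \<le> (?B - ?C)\<^sup>2" by simp
    show ?thesis
    proof (cases "{b, c} \<in> E")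
      case True
      show ?thesis
        by (rule quadratic_root_real[where b = "?B + ?C" and c = "?B * ?C - ?r"])
          (use root True sq in \<open>simp_all add: power2_eq_square algebra_simps\<close>)
    next
      case False
      show ?thesis
        by (rule quadratic_root_real[where b = "?B + ?C + 1" and c = "?B * ?C"])
          (use root False sq in \<open>simp_all add: power2_eq_square algebra_simps\<close>)
    qed
  next
    case 4
    then obtain a b c where S: "S = {a, b, c}" and ne: "a \<noteq> b" "a \<noteq> c" "b \<noteq> c"
      by (auto simp: card_3_iff)
    let ?d = "\<lambda>T. card (common_nbrs E T I)"
    have notin: "a \<notin> I" "b \<notin> I" "c \<notin> I" using assms(3) S by auto
    show ?thesis
      by (rule cubic_root_real_residual[where A = "?d {a}" and B = "?d {b}" and C = "?d {c}" and p = "?d {a, b}"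
            and q = "?d {a, c}" and r = "?d {b, c}" and s = "?d {a, b, c}" and u = "{a, b} \<notin> E"
            and v = "{a, c} \<notin> E" and w = "{b, c} \<notin> E"])
        (use assms(7) residual_triple[OF fin(2) notin ne assms(5,6)] S in \<open>auto intro!: mono\<close>)
  qed
qed

theorem theorem3p5:
  fixes V :: "'a set" and E :: "'a set set"
  assumes "finite_simple_graph V E"
    and "vertex_cover_number V (complement_edges V E) \<le> 3"
  shows "\<forall>z::complex. poly (map_poly complex_of_real (sigma_poly V E)) z = 0 \<longrightarrow> z \<in> \<real>"
proof (intro allI impI)
  fix z :: complex
  assume "poly (map_poly complex_of_real (sigma_poly V E)) z = 0"
  then have gf0: "partition_gf E V z = 0" by (simp add: poly_sigma_poly[OF assms(1)])
  have fin: "finite V" using assms(1) by (simp add: finite_simple_graph_def)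
  have "vertex_cover V (complement_edges V E) V"
    by (auto simp: vertex_cover_def complement_edges_def nsets_def dest: Int_absorb2)
  \<comment> \<open>The \<open>LEAST\<close> is attained because some cover exists, namely
    \<open>V\<close>.\<close>
  then have "\<exists>k S. vertex_cover V (complement_edges V E) S \<and> card S = k" by blast
  then have "\<exists>S. vertex_cover V (complement_edges V E) S
      \<and> card S = vertex_cover_number V (complement_edges V E)"
    unfolding vertex_cover_number_def
    by (rule LeastI_ex[where P = "\<lambda>k. \<exists>S. vertex_cover V (complement_edges V E) S \<and> card S = k"])
  then obtain S where S: "vertex_cover V (complement_edges V E) S" "card S \<le> 3"
    using assms(2) by auto
  then have sub: "S \<subseteq> V" by (simp add: vertex_cover_def)
  have cl: "clique (V - S) E"
    unfolding clique_def
  proof safe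
    fix x y assume xy: "x \<in> V" "x \<notin> S" "y \<in> V" "y \<notin> S" "x \<noteq> y"
    show "{x, y} \<in> E"
    proof (rule ccontr)
      assume "{x, y} \<notin> E"
      then have "{x, y} \<in> complement_edges V E"
        using xy by (simp add: complement_edges_def nsets_def)
      then have "{x, y} \<inter> S \<noteq> {}" using S(1) unfolding vertex_cover_def by blast
      then show False using xy by simp
    qed
  qed
  show "z \<in> \<real>"
  \<comment> \<open>The root 0 is real already, so dividing by the power of \<open>z\<close> is safe
    in the remaining case.\<close>
  proof (cases "z = 0")
    case False
    have "S \<union> (V - S) = V" using sub by auto
    then have "residual E S (V - S) z = 0" using gf0 by (simp add: residual_def)
    then show ?thesis
      using residual_root_real[of S "V - S" E z] False S(2) cl fin sub finite_subset by auto
  qed simp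
qed

end
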